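(* Let $\nu\ge 0$, $\alpha>0$, and let $f\in C^\infty(0,\infty)$ have support $[a,b]$ with $0<a<b<\infty$. Put $h(t)=t^{\frac{\nu-1}{2}}f(\sqrt t)$ for $t>0$. Then for all $x>0$ $$ (B_{\nu,-}^{-\alpha}f)(x)=\frac{1}{2^{2\alpha}}\,\bigl(J^{\,2\alpha,\ \frac{\nu-1}{2}-\alpha,\ -\alpha}h\bigr)(x^2), $$ where $J^{\gamma,\beta,\eta}$ is the Saigo fractional integral.
   Context: For $\nu\ge 0$, $\alpha>0$ the fractional Bessel integral on the semiaxis $(0,\infty)$ is defined by $$ (B_{\nu,-}^{-\alpha}f)(x)=\frac{1}{\Gamma(2\alpha)}\int_x^{+\infty}\left(\frac{y^2-x^2}{2y}\right)^{2\alpha-1}{}_2F_1\left(\alpha+\frac{\nu-1}{2},\alpha;2\alpha;1-\frac{x^2}{y^2}\right)f(y)\,dy,\qquad x>0, $$ where ${}_2F_1$ is the Gauss hypergeometric function. For $\gamma>0$ and real $\beta,\eta$, the Saigo fractional integral is $$ (J^{\gamma,\beta,\eta}h)(x)=\frac{1}{\Gamma(\gamma)}\int_x^\infty (t-x)^{\gamma-1}t^{-\gamma-\beta}\,{}_2F_1\left(\gamma+\beta,-\eta;\gamma;1-\frac{x}{t}\right)h(t)\,dt,\qquad x>0. $$ *)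

theory Defs
  imports "HOL-Analysis.Analysis"
begin

(* C-infinity on an open set S of reals; f may be arbitrary outside S. *)
definition smooth_on :: "real set \<Rightarrow> (real \<Rightarrow> 'a::real_normed_vector) \<Rightarrow> bool" where
  "smooth_on S f \<longleftrightarrow>
     (\<forall>n. (((\<lambda>g t. vector_derivative g (at t)) ^^ n) f) differentiable_on S)"

(* The Gauss series, convergent for \<bar>z\<bar> < 1; the integrals below only use 0 \<le> z < 1. *)
definition gauss_2F1 :: "real \<Rightarrow> real \<Rightarrow> real \<Rightarrow> real \<Rightarrow> real" where
  "gauss_2F1 a b c z = eval_fps (fps_hypergeo [a, b] [c] 1) z"

definition bessel_frac_integral :: "real \<Rightarrow> real \<Rightarrow> (real \<Rightarrow> complex) \<Rightarrow> real \<Rightarrow> complex" where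
  "bessel_frac_integral \<nu> \<alpha> f x =
     (1 / Gamma (2 * \<alpha>)) *\<^sub>R
       (LINT y:{x<..}|lborel.
          (((y\<^sup>2 - x\<^sup>2) / (2 * y)) powr (2 * \<alpha> - 1)
            * gauss_2F1 (\<alpha> + (\<nu> - 1) / 2) \<alpha> (2 * \<alpha>) (1 - x\<^sup>2 / y\<^sup>2)) *\<^sub>R f y)"

definition saigo_integral ::
    "real \<Rightarrow> real \<Rightarrow> real \<Rightarrow> (real \<Rightarrow> complex) \<Rightarrow> real \<Rightarrow> complex" where
  "saigo_integral \<gamma> \<beta> \<eta> h x =
     (1 / Gamma \<gamma>) *\<^sub>R
       (LINT t:{x<..}|lborel.
          ((t - x) powr (\<gamma> - 1) * t powr (- \<gamma> - \<beta>)
            * gauss_2F1 (\<gamma> + \<beta>) (- \<eta>) \<gamma> (1 - x / t)) *\<^sub>R h t)"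

end

theory Submission
  imports Defs
begin

text \<open>The substitution t = y^2 carries {x<..} onto {x^2<..} and turns the Saigo integral at
  x^2 into the Bessel integral at x. With \<gamma> = 2\<alpha>, \<beta> = (\<nu>-1)/2 - \<alpha> and
  \<eta> = -\<alpha>, both hypergeometric factors have the same parameters, and 1 - x^2/t becomes 1
  - x^2/y^2. Only powers remain: the weight in \<open>h\<close> reduces t^(-\<gamma>-\<beta>) to
  t^(-\<alpha>) = y^(-2\<alpha>), and the Jacobian 2y turns this into 2^(2\<alpha>)
  (2y)^(1-2\<alpha>), which supplies both the denominator of the Bessel kernel and the constant
  (\<open>saigo_bessel_kernel\<close>). The analytic step is
  \<open>set_integral_change_of_variables_real\<close>. It asks for measurability rather than
  integrability, so convergence at the endpoint t = x^2 need not be discussed.\<close>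

lemma set_integral_change_of_variables_real:
  fixes F :: "real \<Rightarrow> 'a :: euclidean_space" and g g' :: "real \<Rightarrow> real"
  assumes S: "S \<in> sets borel"
    and deriv: "\<And>x. x \<in> S \<Longrightarrow> (g has_field_derivative g' x) (at x within S)"
    and inj: "inj_on g S"
    and meas: "set_borel_measurable borel (g ` S) F"
      "set_borel_measurable borel S (\<lambda>x. \<bar>g' x\<bar> *\<^sub>R F (g x))"
  shows "(LINT t:g ` S|lborel. F t) = (LINT x:S|lborel. \<bar>g' x\<bar> *\<^sub>R F (g x))"
proof -
  let ?G = "\<lambda>x. \<bar>g' x\<bar> *\<^sub>R F (g x)"
  \<comment> \<open>The change of variables theorem concerns Lebesgue measure; for Borel integrands,
    passing to the completion does not alter the integral.\<close>
  have to_lebesgue: "(LINT t:A|lborel. H t) = (LINT t:A|lebesgue. H t)"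
    if "set_borel_measurable borel A H" for A and H :: "real \<Rightarrow> 'a"
    using that unfolding set_lebesgue_integral_def set_borel_measurable_def
    by (simp add: integral_completion)
  note cov = has_absolute_integral_change_of_variables_real[of S g g' F, OF _ deriv inj]
  have S': "S \<in> sets lebesgue"
    using S by simp
  show ?thesis
  proof (cases "F absolutely_integrable_on g ` S")
    case True
    then have "?G absolutely_integrable_on S" "integral S ?G = integral (g ` S) F"
      using cov[OF S'] by blast+
    with True show ?thesis
      by (simp add: to_lebesgue[OF meas(1)] to_lebesgue[OF meas(2)]
          set_lebesgue_integral_eq_integral)
  \<comment> \<open>Integrability fails on both sides simultaneously, and then both Bochner
    integrals take the default value 0.\<close>
  next
    case False
    then have "\<not> ?G absolutely_integrable_on S"
      using cov[OF S'] by blast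
    with False show ?thesis
      unfolding to_lebesgue[OF meas(1)] to_lebesgue[OF meas(2)]
      by (simp add: set_integrable_def set_lebesgue_integral_def not_integrable_integral_eq)
  qed
qed

lemma image_power2_greaterThan:
  fixes x :: real
  assumes "0 \<le> x"
  shows "(\<lambda>y. y\<^sup>2) ` {x<..} = {x\<^sup>2<..}"
proof (intro subset_antisym subsetI)
  fix t assume "t \<in> {x\<^sup>2<..}"
  then have "t = (sqrt t)\<^sup>2" "sqrt t \<in> {x<..}"
    using assms le_less_trans[OF zero_le_power2[of x], of t]
    by (auto intro: real_less_rsqrt)
  then show "t \<in> (\<lambda>y. y\<^sup>2) ` {x<..}"
    by blast
qed (use assms in \<open>auto intro: power_strict_mono\<close>)

text \<open>A pointwise \<open>suminf\<close> of Borel functions is Borel on the whole line,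
  including where the series diverges.\<close>

lemma borel_measurable_gauss_2F1 [measurable]: "gauss_2F1 a b c \<in> borel_measurable borel"
proof -
  have "gauss_2F1 a b c = (\<lambda>z. \<Sum>n. fps_nth (fps_hypergeo [a, b] [c] 1) n * z ^ n)"
    by (simp add: fun_eq_iff gauss_2F1_def eval_fps_def)
  then show ?thesis
    by simp
qed

lemma smooth_on_imp_continuous_on:
  assumes "smooth_on S f"
  shows "continuous_on S f"
  using assms[unfolded smooth_on_def, rule_format, of 0]
  by (simp add: differentiable_imp_continuous_on)

text \<open>Off \<open>A\<close> the function \<open>f\<close> is arbitrary, so the indicator is
  attached to \<open>f\<close> before multiplying by \<open>k\<close>.\<close>

lemma set_borel_measurable_scaleR:
  fixes k :: "real \<Rightarrow> real" and f :: "real \<Rightarrow> 'a :: {banach, second_countable_topology}"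
  assumes "k \<in> borel_measurable borel" "A \<in> sets borel" "continuous_on A f"
  shows "set_borel_measurable borel A (\<lambda>x. k x *\<^sub>R f x)"
proof -
  have "(\<lambda>x. k x *\<^sub>R (indicator A x *\<^sub>R f x)) \<in> borel_measurable borel"
    using assms by (intro borel_measurable_scaleR borel_measurable_continuous_on_indicator)
  then show ?thesis
    by (simp add: set_borel_measurable_def mult.commute)
qed

text \<open>The power part of the substitution: 2y is the Jacobian, and the last power of y^2 is the
  weight in \<open>h\<close>. It rests on 2y y^(-2\<alpha>) = 2^(2\<alpha>)
  (2y)^(1-2\<alpha>).\<close>

lemma saigo_bessel_kernel:
  fixes x y \<alpha> \<nu> :: real
  assumes "0 < x" "x < y"
  shows "2 * y * ((y\<^sup>2 - x\<^sup>2) powr (2 * \<alpha> - 1) * (y\<^sup>2) powr (- \<alpha> - (\<nu> - 1) / 2)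
           * (y\<^sup>2) powr ((\<nu> - 1) / 2))
       = 2 powr (2 * \<alpha>) * ((y\<^sup>2 - x\<^sup>2) / (2 * y)) powr (2 * \<alpha> - 1)"
proof -
  have y: "0 < y" and d: "0 \<le> y\<^sup>2 - x\<^sup>2"
    using assms by (auto intro: power_mono)
  have "(y\<^sup>2) powr (- \<alpha> - (\<nu> - 1) / 2) * (y\<^sup>2) powr ((\<nu> - 1) / 2) = (y\<^sup>2) powr (- \<alpha>)"
    by (simp flip: powr_add)
  also have "\<dots> = y powr (- 2 * \<alpha>)"
    using y by (simp add: powr_powr flip: powr_numeral)
  finally have e: "(y\<^sup>2) powr (- \<alpha> - (\<nu> - 1) / 2) * (y\<^sup>2) powr ((\<nu> - 1) / 2) = y powr (- 2 * \<alpha>)" .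
  \<comment> \<open>Stated for arbitrary d \<ge> 0, so that the difference of squares stays an atom
    during simplification.\<close>
  have "2 powr (2 * \<alpha>) * (d / (2 * y)) powr (2 * \<alpha> - 1)
      = d powr (2 * \<alpha> - 1) * (2 * y * y powr (- 2 * \<alpha>))"
    if "0 \<le> d" for d
    using y that by (simp add: powr_divide powr_mult powr_diff powr_minus field_simps)
  from this[OF d] show ?thesis
    using e by (simp add: mult_ac)
qed

theorem mainTheorem3:
  fixes \<nu> \<alpha> a b :: real and f h :: "real \<Rightarrow> complex"
  assumes "\<nu> \<ge> 0" and "\<alpha> > 0"
    and "smooth_on {0<..} f"
    and "0 < a" and "a < b"
    and "top_of_set {0<..} closure_of (support_on {0<..} f) = {a..b}"
    and "\<And>t. t > 0 \<Longrightarrow> h t = (t powr ((\<nu> - 1) / 2)) *\<^sub>R f (sqrt t)"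
  shows "\<forall>x>0. bessel_frac_integral \<nu> \<alpha> f x =
           (1 / 2 powr (2 * \<alpha>)) *\<^sub>R
             saigo_integral (2 * \<alpha>) ((\<nu> - 1) / 2 - \<alpha>) (- \<alpha>) h (x\<^sup>2)"
proof (intro allI impI)
  fix x :: real
  assume x: "0 < x"
  \<comment> \<open>The common hypergeometric factor: \<gamma> + \<beta> = \<alpha> + (\<nu>-1)/2
    and -\<eta> = \<alpha>. Below, \<open>k\<close> and \<open>l\<close> are the Bessel and Saigo
    kernels.\<close>
  define F where "F = gauss_2F1 (\<alpha> + (\<nu> - 1) / 2) \<alpha> (2 * \<alpha>)"
  define k where "k = (\<lambda>y. ((y\<^sup>2 - x\<^sup>2) / (2 * y)) powr (2 * \<alpha> - 1) * F (1 - x\<^sup>2 / y\<^sup>2))"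
  define l where "l = (\<lambda>t. (t - x\<^sup>2) powr (2 * \<alpha> - 1) * t powr (- \<alpha> - (\<nu> - 1) / 2)
    * F (1 - x\<^sup>2 / t))"
  have F [measurable]: "F \<in> borel_measurable borel"
    by (simp add: F_def)
  have k: "k \<in> borel_measurable borel" and l: "l \<in> borel_measurable borel"
    unfolding k_def l_def by measurable
  have f: "continuous_on {0<..} f"
    by (rule smooth_on_imp_continuous_on) fact
  \<comment> \<open>The formula for \<open>h\<close> holds only for t > 0, which x^2 < t
    guarantees.\<close>
  have "continuous_on {x\<^sup>2<..} (\<lambda>t. t powr ((\<nu> - 1) / 2) *\<^sub>R f (sqrt t))"
    using x by (intro continuous_intros continuous_on_compose2[OF f])
      (auto dest: le_less_trans[OF zero_le_power2])
  then have h: "continuous_on {x\<^sup>2<..} h"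
    using assms(7) le_less_trans[OF zero_le_power2[of x]]
    by (subst continuous_on_cong[OF refl]) auto
  have kernel: "\<bar>2 * y\<bar> *\<^sub>R (l (y\<^sup>2) *\<^sub>R h (y\<^sup>2)) = (2 powr (2 * \<alpha>) * k y) *\<^sub>R f y"
    if "y \<in> {x<..}" for y
  proof -
    from that x have "0 < y" "x < y" by auto
    then show ?thesis
      using saigo_bessel_kernel[OF x, of y \<alpha> \<nu>]
      by (simp add: assms(7) k_def l_def mult_ac)
  qed
  have "continuous_on {x<..} f"
    by (rule continuous_on_subset[OF f]) (use x in auto)
  with k have "set_borel_measurable borel {x<..} (\<lambda>y. (2 powr (2 * \<alpha>) * k y) *\<^sub>R f y)"
    by (intro set_borel_measurable_scaleR) auto
  \<comment> \<open>Measurability of the pulled-back integrand is read off from its Bessel form via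
    \<open>kernel\<close>.\<close>
  then have m: "set_borel_measurable borel {x<..} (\<lambda>y. \<bar>2 * y\<bar> *\<^sub>R (l (y\<^sup>2) *\<^sub>R h (y\<^sup>2)))"
    unfolding set_borel_measurable_def
    by (rule measurable_cong[THEN iffD1, rotated]) (auto simp: indicator_def simp flip: kernel)
  have "(LINT t:{x\<^sup>2<..}|lborel. l t *\<^sub>R h t)
      = (LINT t:(\<lambda>y. y\<^sup>2) ` {x<..}|lborel. l t *\<^sub>R h t)"
    using x by (simp add: image_power2_greaterThan)
  also have "\<dots> = (LINT y:{x<..}|lborel. \<bar>2 * y\<bar> *\<^sub>R (l (y\<^sup>2) *\<^sub>R h (y\<^sup>2)))"
  proof (rule set_integral_change_of_variables_real)
    show "inj_on (\<lambda>y. y\<^sup>2) {x<..}"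
      using x by (auto intro!: inj_onI)
    show "set_borel_measurable borel ((\<lambda>y. y\<^sup>2) ` {x<..}) (\<lambda>t. l t *\<^sub>R h t)"
      using x l h by (simp add: image_power2_greaterThan set_borel_measurable_scaleR)
  qed (use m in \<open>auto intro!: derivative_eq_intros\<close>)
  also have "\<dots> = (LINT y:{x<..}|lborel. 2 powr (2 * \<alpha>) *\<^sub>R (k y *\<^sub>R f y))"
    by (rule set_lebesgue_integral_cong) (use kernel in auto)
  also have "\<dots> = 2 powr (2 * \<alpha>) *\<^sub>R (LINT y:{x<..}|lborel. k y *\<^sub>R f y)"
    by (rule set_integral_scaleR_right)
  finally show "bessel_frac_integral \<nu> \<alpha> f x = (1 / 2 powr (2 * \<alpha>)) *\<^sub>R
      saigo_integral (2 * \<alpha>) ((\<nu> - 1) / 2 - \<alpha>) (- \<alpha>) h (x\<^sup>2)"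
    by (simp add: bessel_frac_integral_def saigo_integral_def k_def l_def F_def algebra_simps)
qed

end
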